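(* Let $T$ be a metric space. All max-stable random fields below have standard Fréchet marginals. a) The set of continuous extremal coefficient functions $\theta:\mathcal F(T)\to[0,\infty)$ of max-stable random fields on $T$ coincides with the set of extremal coefficient functions of stochastically continuous max-stable random fields on $T$. b) The set of continuous extremal correlation functions $\chi:T\times T\to[0,1]$ of max-stable random fields on $T$ coincides with the set of extremal correlation functions of stochastically continuous max-stable random fields on $T$.
   Context: A random field $X=\{X_t\}_{t\in T}$ has standard Fréchet marginals if $\mathbb P(X_t\le x)=e^{-1/x}$ for all $t\in T$, $x\ge 0$ (value $0$ at $x=0$). Such a field is max-stable if for every $n\ge1$ and independent copies $X^{(1)},\dots,X^{(n)}$ of $X$ the field $n^{-1}\max_{i}X^{(i)}$ has the same (finite-dimensional) distributions as $X$. $\mathcal F(T)$ denotes the set of finite subsets of $T$. The extremal coefficient function is $\theta:\mathcal F(T)\to[0,\infty)$, $\theta(\emptyset):=0$, $\theta(M):=-x\log\mathbb P(\max_{t\in M}X_t\le x)$ for non-empty finite $M$ and any $x\in(0,\infty)$ (independent of $x$). The extremal correlation function is $\chi(s,t):=\lim_{x\uparrow\infty}\mathbb P(X_s\ge x\mid X_t\ge x)=2-\theta(\{s,t\})$. A function $f:\mathcal F(T)\to\mathbb R$ is continuous if for all $m\ge0$ the induced function $f^{(m)}:T^m\to\mathbb R$, $f^{(m)}(t_1,\dots,t_m)=f(\{t_1,\dots,t_m\})$, is continuous. A random field $X$ on a metric space $T$ is stochastically continuous if $X_{t_n}\to X_t$ in probability whenever $t_n\to t$ in $T$. *)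

theory Defs
  imports "HOL-Probability.Probability" "HOL-Library.FSet"
begin

text \<open>
  A random field on \<open>'t\<close> is a family \<open>X :: 't \<Rightarrow> 'w \<Rightarrow> real\<close> of random variables on a probability
  space \<open>M :: 'w measure\<close>. HOL cannot quantify over types inside a formula, so the sample type
  \<open>'w\<close> stays a free type variable: results are to be stated for every \<open>'w\<close>.
\<close>

definition random_field :: "'w measure \<Rightarrow> ('t \<Rightarrow> 'w \<Rightarrow> real) \<Rightarrow> bool" where
  "random_field M X \<longleftrightarrow> prob_space M \<and> (\<forall>t. X t \<in> borel_measurable M)"

definition standard_Frechet_marginals :: "'w measure \<Rightarrow> ('t \<Rightarrow> 'w \<Rightarrow> real) \<Rightarrow> bool" where
  "standard_Frechet_marginals M X \<longleftrightarrow>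
     (\<forall>t. \<forall>x\<ge>0. \<P>(\<omega> in M. X t \<omega> \<le> x) = (if x = 0 then 0 else exp (- 1 / x)))"

definition same_fdds ::
  "'v measure \<Rightarrow> ('t \<Rightarrow> 'v \<Rightarrow> real) \<Rightarrow> 'w measure \<Rightarrow> ('t \<Rightarrow> 'w \<Rightarrow> real) \<Rightarrow> bool" where
  "same_fdds N Y M X \<longleftrightarrow>
     (\<forall>F. finite F \<longrightarrow>
        distr N (Pi\<^sub>M F (\<lambda>_. borel)) (\<lambda>\<omega>. \<lambda>t\<in>F. Y t \<omega>) =
        distr M (Pi\<^sub>M F (\<lambda>_. borel)) (\<lambda>\<omega>. \<lambda>t\<in>F. X t \<omega>))"

definition independent_copies ::
  "nat \<Rightarrow> 'v measure \<Rightarrow> (nat \<Rightarrow> 't \<Rightarrow> 'v \<Rightarrow> real) \<Rightarrow> 'w measure \<Rightarrow> ('t \<Rightarrow> 'w \<Rightarrow> real) \<Rightarrow> bool" where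
  "independent_copies n N Y M X \<longleftrightarrow>
     (\<forall>i<n. random_field N (Y i) \<and> same_fdds N (Y i) M X) \<and>
     prob_space.indep_vars N (\<lambda>_. Pi\<^sub>M UNIV (\<lambda>_. borel)) (\<lambda>i \<omega> t. Y i t \<omega>) {..<n}"

text \<open>
  The copies need not exist on \<open>M\<close> itself. They live on sample spaces of type \<open>nat \<Rightarrow> 'w\<close>, which
  include the product space \<open>Pi\<^sub>M {..<n} (\<lambda>_. M)\<close> with the copies \<open>\<lambda>i t \<omega>. X t (\<omega> i)\<close>. Hence the
  condition is never vacuous, and since the law of the maximum is determined by the law of \<open>X\<close>,
  the choice of this type is immaterial.
\<close>

definition max_stable :: "'w measure \<Rightarrow> ('t \<Rightarrow> 'w \<Rightarrow> real) \<Rightarrow> bool" where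
  "max_stable M X \<longleftrightarrow>
     (\<forall>n\<ge>1. \<forall>(N :: (nat \<Rightarrow> 'w) measure) Y. prob_space N \<longrightarrow> independent_copies n N Y M X \<longrightarrow>
        same_fdds N (\<lambda>t \<omega>. (MAX i\<in>{..<n}. Y i t \<omega>) / real n) M X)"

definition Frechet_max_stable_field :: "'w measure \<Rightarrow> ('t \<Rightarrow> 'w \<Rightarrow> real) \<Rightarrow> bool" where
  "Frechet_max_stable_field M X \<longleftrightarrow>
     random_field M X \<and> standard_Frechet_marginals M X \<and> max_stable M X"

definition stochastically_continuous ::
  "'w measure \<Rightarrow> ('t::metric_space \<Rightarrow> 'w \<Rightarrow> real) \<Rightarrow> bool" where
  "stochastically_continuous M X \<longleftrightarrow>
     (\<forall>s t. s \<longlonglongrightarrow> t \<longrightarrow>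
        (\<forall>\<epsilon>>0. (\<lambda>n. \<P>(\<omega> in M. \<bar>X (s n) \<omega> - X t \<omega>\<bar> > \<epsilon>)) \<longlonglongrightarrow> 0))"

text \<open>The type \<open>'t fset\<close> of finite sets plays the role of \<open>\<F>(T)\<close>.\<close>

definition extremal_coefficient :: "'w measure \<Rightarrow> ('t \<Rightarrow> 'w \<Rightarrow> real) \<Rightarrow> 't fset \<Rightarrow> real" where
  "extremal_coefficient M X A =
     (if A = {||} then 0
      else THE c. \<forall>x>0. c = - x * ln (\<P>(\<omega> in M. (MAX t\<in>fset A. X t \<omega>) \<le> x)))"

definition extremal_correlation :: "'w measure \<Rightarrow> ('t \<Rightarrow> 'w \<Rightarrow> real) \<Rightarrow> 't \<times> 't \<Rightarrow> real" where
  "extremal_correlation M X =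
     (\<lambda>(s, t). Lim at_top (\<lambda>x. \<P>(\<omega> in M. X s \<omega> \<ge> x \<bar> X t \<omega> \<ge> x)))"

text \<open>
  \<open>T\<^sup>m\<close> is the product topology on the functions \<open>{..<m} \<rightarrow>\<^sub>E UNIV\<close>.
\<close>

definition continuous_on_finite_sets :: "('t::metric_space fset \<Rightarrow> real) \<Rightarrow> bool" where
  "continuous_on_finite_sets f \<longleftrightarrow>
     (\<forall>m::nat. continuous_map (product_topology (\<lambda>_. euclidean) {..<m}) euclideanreal
        (\<lambda>t. f (fset_of_list (map t [0..<m]))))"

end

(*
  A max-stable field X satisfies P(max over A of X <= x) = exp(-theta(A)/x), hence
  P(X_s <= a < X_t) = exp(-1/a) - exp(-theta({s,t})/a). This vanishes as theta({s,t}) -> 1 = theta({t}),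
  and separating X_s from X_t by finitely many levels a shows that X itself is stochastically
  continuous as soon as theta is continuous on pairs; no other field with the same theta is needed.
  Conversely, stochastic continuity makes the finite-dimensional distribution functions continuous
  in the index points. The correlation function reduces to this via chi(s,t) = 2 - theta({s,t}).
*)
theory Submission
  imports Defs "HOL-Real_Asymp.Real_Asymp"
begin

section \<open>Independent copies on a product space\<close>

text \<open>The joint law of the coordinates is the product measure itself, and this is also the
  product of their marginal laws, so the criterion by product laws applies.\<close>

lemma indep_vars_PiM_coordinates:
  assumes "\<And>i. i \<in> I \<Longrightarrow> prob_space (M i)" and "I \<noteq> {}"
  shows "prob_space.indep_vars (Pi\<^sub>M I M) M (\<lambda>i \<omega>. \<omega> i) I"
proof -
  interpret prob_space "Pi\<^sub>M I M"
    by (rule prob_space_PiM) (fact assms)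
  have "distr (Pi\<^sub>M I M) (Pi\<^sub>M I M) (\<lambda>\<omega>. \<lambda>i\<in>I. \<omega> i) = distr (Pi\<^sub>M I M) (Pi\<^sub>M I M) (\<lambda>\<omega>. \<omega>)"
    by (rule distr_cong) (auto simp: space_PiM)
  moreover have "(\<Pi>\<^sub>M i\<in>I. distr (Pi\<^sub>M I M) (M i) (\<lambda>\<omega>. \<omega> i)) = Pi\<^sub>M I M"
    by (intro PiM_cong refl distr_PiM_component assms)
  ultimately show ?thesis
    using assms(2) by (subst indep_vars_iff_distr_eq_PiM') auto
qed

text \<open>Since \<open>max_stable\<close> quantifies over all families of independent copies, one
  concrete family is required to extract anything from it; the coordinates of the n-fold product of
  \<open>M\<close> provide one.\<close>

lemma independent_copies_PiM:
  fixes n :: nat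
  assumes "random_field M (X :: 't \<Rightarrow> 'w \<Rightarrow> real)" and "n \<ge> 1"
  shows "independent_copies n (Pi\<^sub>M {..<n} (\<lambda>_. M)) (\<lambda>i t \<omega>. X t (\<omega> i)) M X"
proof -
  let ?N = "Pi\<^sub>M {..<n} (\<lambda>_. M)"
  interpret prob_space M
    using assms(1) by (simp add: random_field_def)
  have X [measurable]: "X t \<in> borel_measurable M" for t
    using assms(1) by (simp add: random_field_def)
  interpret N: prob_space ?N
    by (rule prob_space_PiM) (rule prob_space_axioms)
  have "random_field ?N (\<lambda>t \<omega>. X t (\<omega> i))" if "i < n" for i
    using that N.prob_space_axioms by (auto simp: random_field_def)
  moreover have "same_fdds ?N (\<lambda>t \<omega>. X t (\<omega> i)) M X" if "i < n" for i
    unfolding same_fdds_def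
  proof (intro allI impI)
    fix F :: "'t set" assume "finite F"
    let ?P = "Pi\<^sub>M F (\<lambda>_. borel :: real measure)"
    have "distr ?N ?P (\<lambda>\<omega>. \<lambda>t\<in>F. X t (\<omega> i)) = distr (distr ?N M (\<lambda>\<omega>. \<omega> i)) ?P (\<lambda>\<omega>. \<lambda>t\<in>F. X t \<omega>)"
      using that by (subst distr_distr) (auto simp: comp_def)
    also have "distr ?N M (\<lambda>\<omega>. \<omega> i) = M"
      using that by (intro distr_PiM_component) (auto intro: prob_space_axioms)
    finally show "distr ?N ?P (\<lambda>\<omega>. \<lambda>t\<in>F. X t (\<omega> i)) = distr M ?P (\<lambda>\<omega>. \<lambda>t\<in>F. X t \<omega>)" .
  qed
  moreover have "N.indep_vars (\<lambda>_. Pi\<^sub>M UNIV (\<lambda>_. borel)) (\<lambda>i \<omega> t. X t (\<omega> i)) {..<n}"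
    by (rule N.indep_vars_compose2[OF indep_vars_PiM_coordinates])
       (use assms(2) prob_space_axioms in \<open>auto intro!: measurable_PiM_single' simp: lessThan_empty_iff\<close>)
  ultimately show ?thesis
    by (simp add: independent_copies_def)
qed

section \<open>Joint distribution functions and their scaling\<close>

text \<open>The quantifier replaces the maximum over \<open>A\<close>, so that the empty index set
  needs no special case: there the value is 1.\<close>

definition joint_cdf :: "'w measure \<Rightarrow> ('t \<Rightarrow> 'w \<Rightarrow> real) \<Rightarrow> 't set \<Rightarrow> real \<Rightarrow> real" where
  "joint_cdf M X A x = \<P>(\<omega> in M. \<forall>t\<in>A. X t \<omega> \<le> x)"

locale Frechet_field =
  fixes M :: "'w measure" and X :: "'t \<Rightarrow> 'w \<Rightarrow> real"
  assumes Frechet_max_stable: "Frechet_max_stable_field M X"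
begin

sublocale prob_space M
  using Frechet_max_stable by (simp add: Frechet_max_stable_field_def random_field_def)

lemma random_field: "random_field M X"
  using Frechet_max_stable by (simp add: Frechet_max_stable_field_def)

lemma measurable_field [measurable]: "X t \<in> borel_measurable M"
  using random_field by (simp add: random_field_def)

lemma prob_le: "x > 0 \<Longrightarrow> \<P>(\<omega> in M. X t \<omega> \<le> x) = exp (- 1 / x)"
  using Frechet_max_stable
  by (simp add: Frechet_max_stable_field_def standard_Frechet_marginals_def)

lemma prob_le_0: "\<P>(\<omega> in M. X t \<omega> \<le> 0) = 0"
  using Frechet_max_stable
  by (simp add: Frechet_max_stable_field_def standard_Frechet_marginals_def)

lemma prob_gt:
  assumes "x > 0"
  shows "\<P>(\<omega> in M. X t \<omega> > x) = 1 - exp (- 1 / x)"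
proof -
  have "\<P>(\<omega> in M. X t \<omega> > x) = \<P>(\<omega> in M. \<not> X t \<omega> \<le> x)"
    by (simp add: not_le)
  also have "\<dots> = 1 - \<P>(\<omega> in M. X t \<omega> \<le> x)"
    by (rule prob_neg) measurable
  finally show ?thesis
    using assms by (simp add: prob_le)
qed

text \<open>The rescaled maximum of n copies is at most \<open>x\<close> exactly when every copy is
  at most \<open>real n * x\<close>; independence turns the latter into an n-th power.\<close>

lemma joint_cdf_max_stable:
  fixes n :: nat
  assumes "finite A" and "n \<ge> 1"
  shows "joint_cdf M X A x = joint_cdf M X A (real n * x) ^ n"
proof -
  let ?N = "Pi\<^sub>M {..<n} (\<lambda>_. M)" and ?P = "Pi\<^sub>M A (\<lambda>_. borel :: real measure)"
  let ?B = "Pi\<^sub>E A (\<lambda>_. {..x})" and ?C = "{\<omega>\<in>space M. \<forall>t\<in>A. X t \<omega> \<le> real n * x}"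
  let ?Y = "\<lambda>t \<omega>. (MAX i\<in>{..<n}. X t (\<omega> i)) / real n"
  interpret N: finite_product_prob_space "\<lambda>_. M" "{..<n}"
    by unfold_locales auto
  have "prob_space ?N"
    by (rule prob_space_PiM) (rule prob_space_axioms)
  with Frechet_max_stable independent_copies_PiM[OF random_field assms(2)] assms(2)
  have "same_fdds ?N ?Y M X"
    unfolding Frechet_max_stable_field_def max_stable_def by blast
  then have eq: "distr ?N ?P (\<lambda>\<omega>. \<lambda>t\<in>A. ?Y t \<omega>) = distr M ?P (\<lambda>\<omega>. \<lambda>t\<in>A. X t \<omega>)"
    using assms(1) unfolding same_fdds_def by blast
  have B: "?B \<in> sets ?P"
    using assms(1) by (intro sets_PiM_I_finite) auto
  have C: "?C \<in> sets M"
    using assms(1) by measurable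
  have Y: "?Y t \<in> borel_measurable ?N" for t
    using assms(2) by measurable
  have "joint_cdf M X A x = measure (distr M ?P (\<lambda>\<omega>. \<lambda>t\<in>A. X t \<omega>)) ?B"
    using B by (subst measure_distr) (auto simp: joint_cdf_def intro!: arg_cong[where f = prob])
  also have "\<dots> = measure (distr ?N ?P (\<lambda>\<omega>. \<lambda>t\<in>A. ?Y t \<omega>)) ?B"
    by (simp only: eq)
  also have "\<dots> = measure ?N (Pi\<^sub>E {..<n} (\<lambda>_. ?C))"
  proof (subst measure_distr[OF _ B])
    have max: "?Y t \<omega> \<le> x \<longleftrightarrow> (\<forall>i<n. X t (\<omega> i) \<le> real n * x)" for t \<omega>
      using assms(2) by (auto simp: divide_le_eq lessThan_empty_iff mult.commute)
    show "measure ?N ((\<lambda>\<omega>. \<lambda>t\<in>A. ?Y t \<omega>) -` ?B \<inter> space ?N) = measure ?N (Pi\<^sub>E {..<n} (\<lambda>_. ?C))"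
      by (rule arg_cong[where f = "measure ?N"]) (auto simp: PiE_iff space_PiM max)
  qed (use Y in measurable)
  also have "\<dots> = joint_cdf M X A (real n * x) ^ n"
    using C by (subst N.finite_measure_PiM_emb) (auto simp: joint_cdf_def)
  finally show ?thesis .
qed

text \<open>A union bound over the finitely many indices, each contributing a Frechet tail that
  vanishes at infinity.\<close>

lemma joint_cdf_tendsto_1:
  assumes "finite A"
  shows "(joint_cdf M X A \<longlongrightarrow> 1) at_top"
proof (rule tendsto_sandwich)
  show "\<forall>\<^sub>F x in at_top. 1 - (\<Sum>t\<in>A. 1 - exp (- 1 / x)) \<le> joint_cdf M X A x"
    using eventually_gt_at_top[of 0]
  proof eventually_elim
    case (elim x)
    have "1 - joint_cdf M X A x = \<P>(\<omega> in M. \<not> (\<forall>t\<in>A. X t \<omega> \<le> x))"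
      using assms unfolding joint_cdf_def by (intro prob_neg[symmetric]) measurable
    also have "\<dots> = prob (\<Union>t\<in>A. {\<omega>\<in>space M. X t \<omega> > x})"
      by (rule arg_cong[where f = prob]) (auto simp: not_le)
    also have "\<dots> \<le> (\<Sum>t\<in>A. \<P>(\<omega> in M. X t \<omega> > x))"
      using assms by (intro finite_measure_subadditive_finite) auto
    finally show ?case
      using elim by (simp add: prob_gt)
  qed
  show "\<forall>\<^sub>F x in at_top. joint_cdf M X A x \<le> 1"
    by (simp add: joint_cdf_def)
  show "((\<lambda>x::real. 1 - (\<Sum>t\<in>A. 1 - exp (- 1 / x))) \<longlongrightarrow> 1) at_top"
    proof -
    have "((\<lambda>x::real. 1 - exp (- 1 / x)) \<longlongrightarrow> 0) at_top"
      by real_asymp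
    then have "((\<lambda>x::real. 1 - (\<Sum>t\<in>A. 1 - exp (- 1 / x))) \<longlongrightarrow> 1 - (\<Sum>t\<in>A. 0)) at_top"
      by (intro tendsto_intros)
    then show ?thesis
      by simp
  qed
qed simp

lemma joint_cdf_mono:
  assumes "finite A" and "x \<le> y"
  shows "joint_cdf M X A x \<le> joint_cdf M X A y"
  unfolding joint_cdf_def
proof (rule finite_measure_mono)
  show "{\<omega>\<in>space M. \<forall>t\<in>A. X t \<omega> \<le> y} \<in> events"
    using assms(1) by measurable
qed (use assms(2) in \<open>auto intro: order_trans\<close>)

text \<open>A zero at \<open>x\<close> would propagate by max-stability to all multiples
  \<open>real n * x\<close>, against the limit 1. Positivity makes the logarithms below
  meaningful.\<close>

lemma joint_cdf_pos:
  assumes "finite A" and "x > 0"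
  shows "joint_cdf M X A x > 0"
proof -
  have "filterlim (\<lambda>n. real n * x) at_top sequentially"
    using assms(2) by real_asymp
  then have "(\<lambda>n. joint_cdf M X A (real n * x)) \<longlonglongrightarrow> 1"
    by (rule filterlim_compose[OF joint_cdf_tendsto_1[OF assms(1)]])
  then have "\<forall>\<^sub>F n in sequentially. joint_cdf M X A (real n * x) > 0"
    by (rule order_tendstoD) simp
  then obtain n :: nat where "n \<ge> 1" "joint_cdf M X A (real n * x) > 0"
    by (metis (no_types, lifting) eventually_at_top_linorder nle_le)
  then show ?thesis
    using joint_cdf_max_stable[OF assms(1), of n x] by simp
qed

text \<open>
  Max-stability gives scale invariance of \<open>x \<mapsto> x * ln (joint_cdf M X A x)\<close> under positive rational
  factors only; monotonicity of the distribution function extends it to real ones.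
\<close>
lemma joint_cdf_homogeneous_Rats:
  assumes "finite A" and "x > 0" and "q \<in> \<rat>" and "q > 0"
  shows "q * ln (joint_cdf M X A (q * x)) = ln (joint_cdf M X A x)"
proof -
  have nat: "real n * ln (joint_cdf M X A (real n * y)) = ln (joint_cdf M X A y)"
    if "n \<ge> 1" "y > 0" for n y
    using joint_cdf_max_stable[OF assms(1) that(1), of y] joint_cdf_pos[OF assms(1), of "real n * y"] that
    by (simp add: ln_realpow)
  obtain m n :: nat where mn: "n \<noteq> 0" "\<bar>q\<bar> = real m / real n"
    using Rats_abs_nat_div_natE[OF assms(3)] by metis
  then have q: "q = real m / real n" "m \<ge> 1" "n \<ge> 1"
    using assms(4) by (auto simp: Suc_le_eq intro: Nat.gr0I)
  \<comment> \<open>Both \<open>q * x\<close> and \<open>x\<close> are natural multiples of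
    \<open>x / real n\<close>, where max-stability can be applied with \<open>m\<close> and with
    \<open>n\<close>.\<close>
  have "real m * ln (joint_cdf M X A (real m * (x / real n))) = real n * ln (joint_cdf M X A (real n * (x / real n)))"
    using nat[of m "x / real n"] nat[of n "x / real n"] q assms(2) by simp
  then have "real m * ln (joint_cdf M X A (q * x)) = real n * ln (joint_cdf M X A x)"
    using q by simp
  moreover have "real m = real n * q"
    using q by simp
  ultimately have "real n * (q * ln (joint_cdf M X A (q * x))) = real n * ln (joint_cdf M X A x)"
    by (simp only: mult.assoc)
  then show ?thesis
    using q(3) by simp
qed

text \<open>For rational \<open>q\<close> above \<open>x / y\<close>, monotonicity compares the
  values at \<open>x\<close> and \<open>q * y\<close>, and letting \<open>q\<close> decrease to
  \<open>x / y\<close> gives the claim. Exchanging \<open>x\<close> and \<open>y\<close> yields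
  equality.\<close>

lemma joint_cdf_scale_le:
  assumes "finite A" and "x > 0" and "y > 0"
  shows "x * ln (joint_cdf M X A x) \<le> y * ln (joint_cdf M X A y)"
proof -
  let ?L = "\<lambda>x. ln (joint_cdf M X A x)"
  have *: "q * ?L x \<le> ?L y" if "q \<in> \<rat>" "q > x / y" for q
  proof -
    have "q > 0"
      using that(2) assms by (meson divide_pos_pos less_trans)
    have "?L x \<le> ?L (q * y)"
      using that(2) assms \<open>q > 0\<close>
      by (intro ln_mono joint_cdf_mono joint_cdf_pos) (auto simp: field_simps)
    then show ?thesis
      using joint_cdf_homogeneous_Rats[OF assms(1,3) that(1) \<open>q > 0\<close>] \<open>q > 0\<close>
        mult_left_mono[of "?L x" "?L (q * y)" q] by simp
  qed
  have "(x / y) * ?L x \<le> ?L y"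
  proof (rule ccontr)
    assume less: "\<not> (x / y) * ?L x \<le> ?L y"
    have "?L x \<le> 0"
      using joint_cdf_pos[OF assms(1,2)] by (simp add: joint_cdf_def)
    \<comment> \<open>The limit in \<open>q\<close> is taken by contradiction: a rational strictly
      between \<open>x / y\<close> and \<open>?L y / ?L x\<close> violates the bound. Dividing by
      the negative \<open>?L x\<close> reverses inequalities, and the value 0 has to be treated
      apart.\<close>
    show False
    proof (cases "?L x = 0")
      case True
      obtain q where "q \<in> \<rat>" "q > x / y"
        using Rats_dense_in_real[of "x / y" "x / y + 1"] by auto
      with * True less show False
        by simp
    next
      case False
      with \<open>?L x \<le> 0\<close> less have "x / y < ?L y / ?L x"
        by (simp add: neg_less_divide_eq)
      then obtain q where q: "q \<in> \<rat>" "x / y < q" "q < ?L y / ?L x"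
        using Rats_dense_in_real by blast
      with False \<open>?L x \<le> 0\<close> have "?L y < q * ?L x"
        by (simp add: neg_less_divide_eq)
      with *[OF q(1,2)] show False
        by simp
    qed
  qed
  then show ?thesis
    using assms by (simp add: field_simps)
qed

section \<open>Extremal coefficient and extremal correlation\<close>

text \<open>Independence of the level \<open>x\<close> makes the definite description well defined.
  The convention for the empty set fits because its joint distribution function is 1.\<close>

lemma extremal_coefficient_eq:
  assumes "x > 0"
  shows "extremal_coefficient M X A = - x * ln (joint_cdf M X (fset A) x)"
proof (cases "A = {||}")
  case True
  then show ?thesis
    by (simp add: extremal_coefficient_def joint_cdf_def prob_space)
next
  case False
  then have "fset A \<noteq> {}"
    by (metis bot_fset.rep_eq fset_inject)
  then have "{\<omega>\<in>space M. (MAX t\<in>fset A. X t \<omega>) \<le> y} = {\<omega>\<in>space M. \<forall>t\<in>fset A. X t \<omega> \<le> y}" for y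
    by auto
  then have "extremal_coefficient M X A =
      (THE c. \<forall>y>0. c = - y * ln (joint_cdf M X (fset A) y))"
    using False by (simp add: extremal_coefficient_def joint_cdf_def)
  also have "\<dots> = - x * ln (joint_cdf M X (fset A) x)"
  proof (rule the_equality)
    show "\<forall>y>0. - x * ln (joint_cdf M X (fset A) x) = - y * ln (joint_cdf M X (fset A) y)"
      using assms joint_cdf_scale_le[of "fset A"] by (auto intro!: antisym)
  qed (use assms in blast)
  finally show ?thesis .
qed

lemma joint_cdf_eq:
  assumes "x > 0"
  shows "joint_cdf M X (fset A) x = exp (- extremal_coefficient M X A / x)"
  using assms joint_cdf_pos[of "fset A" x] by (simp add: extremal_coefficient_eq[OF assms])

lemma extremal_coefficient_singleton: "extremal_coefficient M X {|t|} = 1"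
  by (simp add: extremal_coefficient_eq[of 1] joint_cdf_def prob_le)

lemma prob_le_gt:
  assumes "x > 0"
  shows "\<P>(\<omega> in M. X s \<omega> \<le> x \<and> X t \<omega> > x) =
    exp (- 1 / x) - exp (- extremal_coefficient M X {|s, t|} / x)"
proof -
  have "\<P>(\<omega> in M. X s \<omega> \<le> x \<and> X t \<omega> > x) =
      prob ({\<omega>\<in>space M. X s \<omega> \<le> x} - {\<omega>\<in>space M. \<forall>u\<in>fset {|s, t|}. X u \<omega> \<le> x})"
    by (rule arg_cong[where f = prob]) auto
  also have "\<dots> = \<P>(\<omega> in M. X s \<omega> \<le> x) - joint_cdf M X (fset {|s, t|}) x"
    unfolding joint_cdf_def by (rule finite_measure_Diff) (measurable, auto)
  finally show ?thesis
    using assms by (simp only: prob_le joint_cdf_eq)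
qed

text \<open>The atom is contained in every event \<open>y < X t \<le> x\<close>, whose probability
  vanishes as \<open>y\<close> increases to \<open>x\<close>. This permits exchanging weak and
  strict inequalities in the tail events.\<close>

lemma prob_eq:
  assumes "x > 0"
  shows "\<P>(\<omega> in M. X t \<omega> = x) = 0"
proof -
  have "((\<lambda>y. exp (- 1 / x) - exp (- 1 / y)) \<longlongrightarrow> exp (- 1 / x) - exp (- 1 / x)) (at_left x)"
    using assms by (intro tendsto_intros) auto
  moreover have "\<forall>\<^sub>F y in at_left x. \<P>(\<omega> in M. X t \<omega> = x) \<le> exp (- 1 / x) - exp (- 1 / y)"
    using eventually_at_left_real[OF assms]
  proof eventually_elim
    case (elim y)
    have "\<P>(\<omega> in M. X t \<omega> = x) \<le> prob ({\<omega>\<in>space M. X t \<omega> \<le> x} - {\<omega>\<in>space M. X t \<omega> \<le> y})"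
      using elim by (intro finite_measure_mono) auto
    also have "\<dots> = \<P>(\<omega> in M. X t \<omega> \<le> x) - \<P>(\<omega> in M. X t \<omega> \<le> y)"
      using elim by (intro finite_measure_Diff) auto
    finally show ?case
      using elim by (simp add: prob_le)
  qed
  ultimately have "\<P>(\<omega> in M. X t \<omega> = x) \<le> 0"
    using tendsto_lowerbound[where F = "at_left x"] by fastforce
  then show ?thesis
    by (simp add: measure_le_0_iff)
qed

text \<open>The conditional probability is 1 minus the quotient of \<open>prob_le_gt\<close> by the
  tail of \<open>X t\<close>. At infinity the numerator behaves like
  \<open>(?\<theta> - 1) / x\<close> and the tail like \<open>1 / x\<close>, so the quotient tends
  to \<open>?\<theta> - 1\<close>.\<close>

lemma extremal_correlation_eq:
  "extremal_correlation M X (s, t) = 2 - extremal_coefficient M X {|s, t|}"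
proof -
  let ?\<theta> = "extremal_coefficient M X {|s, t|}"
  have "\<P>(\<omega> in M. X s \<omega> \<ge> x \<bar> X t \<omega> \<ge> x) = 1 - (exp (- 1 / x) - exp (- ?\<theta> / x)) / (1 - exp (- 1 / x))"
    if "x > 0" for x
  proof -
    have AE: "AE \<omega> in M. X u \<omega> \<noteq> x" for u
    proof -
      have "AE \<omega> in M. \<omega> \<notin> {\<omega>\<in>space M. X u \<omega> = x}"
        using prob_eq[OF that, of u] by (subst prob_eq_0[symmetric]) auto
      with AE_space show ?thesis
        by eventually_elim simp
    qed
    have "\<P>(\<omega> in M. X s \<omega> \<ge> x \<bar> X t \<omega> \<ge> x) = \<P>(\<omega> in M. X s \<omega> > x \<bar> X t \<omega> > x)"
    proof (rule cond_prob_eq_AE)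
      show "AE \<omega> in M. X t \<omega> \<ge> x \<longrightarrow> (X s \<omega> \<ge> x \<longleftrightarrow> X s \<omega> > x)"
        using AE[of s] by eventually_elim auto
      show "AE \<omega> in M. X t \<omega> \<ge> x \<longleftrightarrow> X t \<omega> > x"
        using AE[of t] by eventually_elim auto
    qed measurable
    moreover have "\<P>(\<omega> in M. X s \<omega> > x \<and> X t \<omega> > x) =
        prob ({\<omega>\<in>space M. X t \<omega> > x} - {\<omega>\<in>space M. X s \<omega> \<le> x \<and> X t \<omega> > x})"
      by (rule arg_cong[where f = prob]) auto
    moreover have "\<dots> = \<P>(\<omega> in M. X t \<omega> > x) - \<P>(\<omega> in M. X s \<omega> \<le> x \<and> X t \<omega> > x)"
      by (rule finite_measure_Diff) auto
    moreover have "1 - exp (- 1 / x) > 0"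
      using that by simp
    ultimately show ?thesis
      using that by (simp add: cond_prob_def prob_gt prob_le_gt) (simp add: field_simps)
  qed
  then have "\<forall>\<^sub>F x in at_top. 1 - (exp (- 1 / x) - exp (- ?\<theta> / x)) / (1 - exp (- 1 / x)) =
      \<P>(\<omega> in M. X s \<omega> \<ge> x \<bar> X t \<omega> \<ge> x)"
    by (intro eventually_mono[OF eventually_gt_at_top[of 0]]) simp
  moreover have "((\<lambda>x. 1 - (exp (- 1 / x) - exp (- c / x)) / (1 - exp (- 1 / x))) \<longlongrightarrow> 2 - c) at_top" for c :: real
    by real_asymp
  ultimately have "((\<lambda>x. \<P>(\<omega> in M. X s \<omega> \<ge> x \<bar> X t \<omega> \<ge> x)) \<longlongrightarrow> 2 - ?\<theta>) at_top"
    by (rule Lim_transform_eventually[rotated])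
  then show ?thesis
    by (simp add: extremal_correlation_def tendsto_Lim)
qed

section \<open>Continuous extremal coefficients give stochastic continuity\<close>

text \<open>
  If two values differ by more than \<open>\<epsilon>\<close>, some point of the grid \<open>\<epsilon> \<nat>\<close> separates them, and
  the probability of separation by a given point is controlled by the extremal coefficient.
\<close>
lemma prob_dist_gt_le:
  assumes "\<epsilon> > 0" and "N \<ge> 1"
  shows "\<P>(\<omega> in M. \<bar>X s \<omega> - X t \<omega>\<bar> > \<epsilon>) \<le> 1 - exp (- 1 / (real N * \<epsilon>)) +
    2 * (\<Sum>k=1..N. exp (- 1 / (real k * \<epsilon>)) - exp (- extremal_coefficient M X {|s, t|} / (real k * \<epsilon>)))"
proof -
  let ?S = "\<lambda>u v k. {\<omega>\<in>space M. X u \<omega> \<le> real k * \<epsilon> \<and> X v \<omega> > real k * \<epsilon>}"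
  \<comment> \<open>Exceptional event: nonpositive values, which have probability 0, and values
    above the last grid point. It suffices to watch \<open>X t\<close> there, because both values
    exceed the last grid point once the smaller one does.\<close>
  let ?A = "{\<omega>\<in>space M. X s \<omega> \<le> 0} \<union> {\<omega>\<in>space M. X t \<omega> \<le> 0} \<union> {\<omega>\<in>space M. X t \<omega> > real N * \<epsilon>}"
  have sep: "(\<exists>k\<in>{1..N}. x \<le> real k * \<epsilon> \<and> real k * \<epsilon> < y) \<or> real N * \<epsilon> < x"
    if "0 < x" "x + \<epsilon> < y" for x y
  proof -
    \<comment> \<open>The first grid point not below \<open>x\<close> overshoots it by less than
      \<open>\<epsilon>\<close>, hence lies below \<open>y\<close>. If its index is greater than
      \<open>N\<close>, then \<open>x\<close> itself lies beyond
      \<open>real N * \<epsilon>\<close>.\<close>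
    define k where "k = nat \<lceil>x / \<epsilon>\<rceil>"
    have k: "real k = of_int \<lceil>x / \<epsilon>\<rceil>"
      using that assms by (simp add: k_def)
    have "x / \<epsilon> \<le> real k" "real k < x / \<epsilon> + 1"
      unfolding k by linarith+
    then have *: "x \<le> real k * \<epsilon>" "real k * \<epsilon> < x + \<epsilon>"
      using assms by (simp_all add: field_simps)
    then have "k \<ge> 1"
      using that assms by (cases k) auto
    show ?thesis
    proof (cases "k \<le> N")
      case True
      then show ?thesis
        using * that \<open>k \<ge> 1\<close> by (intro disjI1 bexI[of _ k]) auto
    next
      case False
      then have "real N + 1 \<le> real k"
        by linarith
      then have "(real N + 1) * \<epsilon> \<le> real k * \<epsilon>"
        using assms by (intro mult_right_mono) auto
      then show ?thesis
        using * by (simp add: algebra_simps)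
    qed
  qed
  have "{\<omega>\<in>space M. \<bar>X s \<omega> - X t \<omega>\<bar> > \<epsilon>} \<subseteq> ?A \<union> (\<Union>k\<in>{1..N}. ?S s t k \<union> ?S t s k)"
  proof
    fix \<omega> assume \<omega>: "\<omega> \<in> {\<omega>\<in>space M. \<bar>X s \<omega> - X t \<omega>\<bar> > \<epsilon>}"
    then consider "X s \<omega> + \<epsilon> < X t \<omega>" | "X t \<omega> + \<epsilon> < X s \<omega>"
      by fastforce
    then show "\<omega> \<in> ?A \<union> (\<Union>k\<in>{1..N}. ?S s t k \<union> ?S t s k)"
    proof cases
      case 1
      then show ?thesis
        using sep[of "X s \<omega>" "X t \<omega>"] \<omega> assms(1) by (fastforce simp: not_le)
    next
      case 2
      then show ?thesis
        using sep[of "X t \<omega>" "X s \<omega>"] \<omega> by (fastforce simp: not_le)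
    qed
  qed
  then have "\<P>(\<omega> in M. \<bar>X s \<omega> - X t \<omega>\<bar> > \<epsilon>) \<le> prob (?A \<union> (\<Union>k\<in>{1..N}. ?S s t k \<union> ?S t s k))"
    by (intro finite_measure_mono) measurable
  also have "\<dots> \<le> prob ?A + prob (\<Union>k\<in>{1..N}. ?S s t k \<union> ?S t s k)"
    by (intro measure_Un_le) measurable
  also have "prob ?A \<le> \<P>(\<omega> in M. X s \<omega> \<le> 0) + \<P>(\<omega> in M. X t \<omega> \<le> 0) + \<P>(\<omega> in M. X t \<omega> > real N * \<epsilon>)"
    by (intro order_trans[OF measure_Un_le] add_mono measure_Un_le order_refl) measurable
  also have "\<dots> = 1 - exp (- 1 / (real N * \<epsilon>))"
    using assms by (simp add: prob_le_0 prob_gt)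
  also have "prob (\<Union>k\<in>{1..N}. ?S s t k \<union> ?S t s k) \<le> (\<Sum>k=1..N. prob (?S s t k \<union> ?S t s k))"
    by (intro finite_measure_subadditive_finite) auto
  also have "\<dots> \<le> (\<Sum>k=1..N. prob (?S s t k) + prob (?S t s k))"
    by (intro sum_mono measure_Un_le) measurable
  also have "\<dots> = 2 * (\<Sum>k=1..N. exp (- 1 / (real k * \<epsilon>)) - exp (- extremal_coefficient M X {|s, t|} / (real k * \<epsilon>)))"
    unfolding sum_distrib_left using assms(1)
    by (intro sum.cong refl) (simp add: prob_le_gt finsert_commute[of t s])
  finally show ?thesis
    by simp
qed

end

locale Frechet_field_metric = Frechet_field M X
  for M :: "'w measure" and X :: "'t::metric_space \<Rightarrow> 'w \<Rightarrow> real"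
begin

text \<open>The grid size \<open>N\<close> is fixed first to make the tail term small; the remaining
  sum is finite and vanishes as the pair coefficient tends to its diagonal value 1.\<close>

lemma stochastically_continuousI:
  assumes "continuous_on UNIV (\<lambda>(s, t). extremal_coefficient M X {|s, t|})"
  shows "stochastically_continuous M X"
  unfolding stochastically_continuous_def
proof (intro allI impI)
  fix s :: "nat \<Rightarrow> 't" and t and \<epsilon> :: real
  assume s: "s \<longlonglongrightarrow> t" and \<epsilon>: "\<epsilon> > 0"
  let ?\<theta> = "\<lambda>n. extremal_coefficient M X {|s n, t|}"
  have "(\<lambda>n. case (s n, t) of (s, t) \<Rightarrow> extremal_coefficient M X {|s, t|}) \<longlonglongrightarrow>
      (case (t, t) of (s, t) \<Rightarrow> extremal_coefficient M X {|s, t|})"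
    by (rule continuous_on_tendsto_compose[OF assms]) (auto intro: tendsto_Pair s)
  then have \<theta>: "?\<theta> \<longlonglongrightarrow> 1"
    by (simp add: extremal_coefficient_singleton)
  show "(\<lambda>n. \<P>(\<omega> in M. \<bar>X (s n) \<omega> - X t \<omega>\<bar> > \<epsilon>)) \<longlonglongrightarrow> 0"
  proof (rule order_tendstoI)
    fix \<delta> :: real assume "\<delta> > 0"
    have "(\<lambda>N. 1 - exp (- 1 / (real N * \<epsilon>))) \<longlonglongrightarrow> 0"
      using \<epsilon> by real_asymp
    then have "\<forall>\<^sub>F N in sequentially. 1 - exp (- 1 / (real N * \<epsilon>)) < \<delta>"
      using \<open>\<delta> > 0\<close> by (rule order_tendstoD)
    with eventually_ge_at_top[of 1] obtain N where N: "N \<ge> 1" "1 - exp (- 1 / (real N * \<epsilon>)) < \<delta>"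
      using eventually_happens[OF eventually_conj] by fastforce
    \<comment> \<open>The bound of \<open>prob_dist_gt_le\<close> as a function of the coefficient;
      at 1 every summand cancels and only the tail term is left.\<close>
    let ?b = "\<lambda>c. 1 - exp (- 1 / (real N * \<epsilon>)) +
      2 * (\<Sum>k=1..N. exp (- 1 / (real k * \<epsilon>)) - exp (- c / (real k * \<epsilon>)))"
    have "(\<lambda>n. ?b (?\<theta> n)) \<longlonglongrightarrow> ?b 1"
      using \<epsilon> by (intro tendsto_intros \<theta>) auto
    then have "\<forall>\<^sub>F n in sequentially. ?b (?\<theta> n) < \<delta>"
      by (rule order_tendstoD) (use N in simp)
    then show "\<forall>\<^sub>F n in sequentially. \<P>(\<omega> in M. \<bar>X (s n) \<omega> - X t \<omega>\<bar> > \<epsilon>) < \<delta>"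
      by eventually_elim (rule le_less_trans[OF prob_dist_gt_le[OF \<epsilon> N(1)]])
  qed (auto intro!: always_eventually less_le_trans[OF _ measure_nonneg])
qed

section \<open>Stochastic continuity gives continuous extremal coefficients\<close>

text \<open>The two threshold events differ only if the values are more than
  \<open>\<epsilon>\<close> apart or \<open>X t\<close> is close to 1, which is unlikely because its
  law has no atom there. The level 1 suffices, as the coefficient can be read off at any positive
  level.\<close>

lemma isCont_prob_threshold:
  assumes "stochastically_continuous M X"
  shows "isCont (\<lambda>s. \<P>(\<omega> in M. (X s \<omega> \<le> 1) \<noteq> (X t \<omega> \<le> 1))) t"
  unfolding continuous_at_sequentially comp_def
proof (intro allI impI)
  fix s :: "nat \<Rightarrow> 't" assume s: "s \<longlonglongrightarrow> t"
  let ?D = "\<lambda>u. \<P>(\<omega> in M. (X u \<omega> \<le> 1) \<noteq> (X t \<omega> \<le> 1))"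
  have "(\<lambda>n. ?D (s n)) \<longlonglongrightarrow> 0"
  proof (rule order_tendstoI)
    fix \<delta> :: real assume "\<delta> > 0"
    \<comment> \<open>The probability of
      \<open>1 - 2 * \<epsilon> < X t \<le> 1 + \<epsilon>\<close>, which covers every disagreement
      of values at distance at most \<open>\<epsilon>\<close>. Taking \<open>\<epsilon>\<close>
      below 1/2 keeps the lower end positive, as \<open>prob_le\<close> requires.\<close>
    let ?g = "\<lambda>\<epsilon>::real. exp (- 1 / (1 + \<epsilon>)) - exp (- 1 / (1 - 2 * \<epsilon>))"
    have "(?g \<longlongrightarrow> 0) (at_right 0)"
      by real_asymp
    then have "\<forall>\<^sub>F \<epsilon> in at_right 0. ?g \<epsilon> < \<delta>"
      using \<open>\<delta> > 0\<close> by (rule order_tendstoD)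
    moreover have "\<forall>\<^sub>F \<epsilon> in at_right 0. \<epsilon> \<in> {0<..<1/2::real}"
      by (rule eventually_at_right_real) simp
    ultimately obtain \<epsilon> where \<epsilon>: "?g \<epsilon> < \<delta>" "0 < \<epsilon>" "\<epsilon> < 1 / 2"
      using eventually_happens[OF eventually_conj] by fastforce
    have le: "?D u \<le> \<P>(\<omega> in M. \<bar>X u \<omega> - X t \<omega>\<bar> > \<epsilon>) + ?g \<epsilon>" for u
    proof -
      let ?E = "{\<omega>\<in>space M. \<bar>X u \<omega> - X t \<omega>\<bar> > \<epsilon>}"
      let ?F = "{\<omega>\<in>space M. X t \<omega> \<le> 1 + \<epsilon>} - {\<omega>\<in>space M. X t \<omega> \<le> 1 - 2 * \<epsilon>}"
      have "?D u \<le> prob (?E \<union> ?F)"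
        using \<epsilon> by (intro finite_measure_mono) auto
      also have "\<dots> \<le> prob ?E + prob ?F"
        by (intro measure_Un_le) measurable
      also have "prob ?F = \<P>(\<omega> in M. X t \<omega> \<le> 1 + \<epsilon>) - \<P>(\<omega> in M. X t \<omega> \<le> 1 - 2 * \<epsilon>)"
        using \<epsilon> by (intro finite_measure_Diff) auto
      finally show ?thesis
        using \<epsilon> by (simp add: prob_le)
    qed
    have "(\<lambda>n. \<P>(\<omega> in M. \<bar>X (s n) \<omega> - X t \<omega>\<bar> > \<epsilon>) + ?g \<epsilon>) \<longlonglongrightarrow> 0 + ?g \<epsilon>"
      using assms s \<epsilon>(2) by (intro tendsto_intros) (auto simp: stochastically_continuous_def)
    then have "\<forall>\<^sub>F n in sequentially. \<P>(\<omega> in M. \<bar>X (s n) \<omega> - X t \<omega>\<bar> > \<epsilon>) + ?g \<epsilon> < \<delta>"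
      by (rule order_tendstoD) (use \<epsilon> in simp)
    then show "\<forall>\<^sub>F n in sequentially. ?D (s n) < \<delta>"
      by eventually_elim (rule le_less_trans[OF le])
  qed (auto intro!: always_eventually less_le_trans[OF _ measure_nonneg])
  then show "(\<lambda>n. ?D (s n)) \<longlonglongrightarrow> ?D t"
    by simp
qed

text \<open>At level 1 the joint distribution functions at two tuples differ by at most the sum of
  the coordinatewise disagreement probabilities, each continuous in its own coordinate. The
  logarithm preserves the limit since the limit is positive.\<close>

lemma continuous_on_finite_sets_extremal_coefficient:
  assumes "stochastically_continuous M X"
  shows "continuous_on_finite_sets (extremal_coefficient M X)"
  unfolding continuous_on_finite_sets_def continuous_map_atin limitin_canonical_iff
proof (intro allI ballI)
  fix m :: nat and t :: "nat \<Rightarrow> 't"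
  let ?T = "product_topology (\<lambda>_. euclidean :: 't topology) {..<m}"
  assume t: "t \<in> topspace ?T"
  let ?G = "\<lambda>u. joint_cdf M X (fset (fset_of_list (map u [0..<m]))) 1"
  let ?D = "\<lambda>u i. \<P>(\<omega> in M. (X (u i) \<omega> \<le> 1) \<noteq> (X (t i) \<omega> \<le> 1))"
  have G: "?G u = \<P>(\<omega> in M. \<forall>i<m. X (u i) \<omega> \<le> 1)" for u
    unfolding joint_cdf_def by (rule arg_cong[where f = prob]) (auto simp: fset_of_list.rep_eq)
  have le: "\<bar>?G u - ?G t\<bar> \<le> (\<Sum>i<m. ?D u i)" for u
  proof -
    \<comment> \<open>One-sided, but the disagreement event is symmetric in the two tuples, so using
      it in both orders bounds the absolute difference.\<close>
    have half: "?G u \<le> ?G v + prob (\<Union>i<m. {\<omega>\<in>space M. (X (u i) \<omega> \<le> 1) \<noteq> (X (v i) \<omega> \<le> 1)})"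
      for u v :: "nat \<Rightarrow> 't"
      unfolding G
      by (intro order_trans[OF finite_measure_mono measure_Un_le]) (auto, measurable)
    have "prob (\<Union>i<m. {\<omega>\<in>space M. (X (u i) \<omega> \<le> 1) \<noteq> (X (t i) \<omega> \<le> 1)}) \<le> (\<Sum>i<m. ?D u i)"
      by (intro finite_measure_subadditive_finite) auto
    then show ?thesis
      using half[of u t] half[of t u] by (simp add: eq_commute[of "X (t _) _ \<le> 1"] abs_le_iff)
  qed
  have "((\<lambda>u. ?D u i) \<longlongrightarrow> 0) (atin ?T t)" if "i < m" for i
  proof -
    have "continuous_map ?T euclidean (\<lambda>u. u i)"
      using that by (intro continuous_map_product_projection) auto
    then have "((\<lambda>u. u i) \<longlongrightarrow> t i) (atin ?T t)"
      using t by (simp add: continuous_map_atin)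
    from isCont_tendsto_compose[OF isCont_prob_threshold[OF assms] this]
    show ?thesis
      by simp
  qed
  then have "((\<lambda>u. \<Sum>i<m. ?D u i) \<longlongrightarrow> (\<Sum>i<m. 0)) (atin ?T t)"
    by (intro tendsto_sum) auto
  then have lim: "((\<lambda>u. \<Sum>i<m. ?D u i) \<longlongrightarrow> 0) (atin ?T t)"
    by simp
  have "((\<lambda>u. ?G u - ?G t) \<longlongrightarrow> 0) (atin ?T t)"
    by (rule Lim_null_comparison[OF always_eventually lim]) (intro allI, unfold real_norm_def, rule le)
  then have "(?G \<longlongrightarrow> ?G t) (atin ?T t)"
    by (rule LIM_zero_cancel)
  then show "((\<lambda>u. extremal_coefficient M X (fset_of_list (map u [0..<m]))) \<longlongrightarrow>
      extremal_coefficient M X (fset_of_list (map t [0..<m]))) (atin ?T t)"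
    unfolding extremal_coefficient_eq[of 1, simplified]
    using joint_cdf_pos[of "fset (fset_of_list (map t [0..<m]))" 1]
    by (intro tendsto_minus tendsto_ln) auto
qed

section \<open>Pairs, correlations and the equivalences\<close>

lemma continuous_extremal_correlation_iff:
  "continuous_on UNIV (extremal_correlation M X) \<longleftrightarrow>
    continuous_on UNIV (\<lambda>(s, t). extremal_coefficient M X {|s, t|})"
proof -
  let ?\<theta> = "\<lambda>(s, t). extremal_coefficient M X {|s, t|}"
  have "extremal_correlation M X = (\<lambda>p. 2 - ?\<theta> p)" "?\<theta> = (\<lambda>p. 2 - extremal_correlation M X p)"
    by (auto simp: extremal_correlation_eq fun_eq_iff)
  then show ?thesis
    using continuous_on_diff[OF continuous_on_const, of UNIV "extremal_correlation M X" 2]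
      continuous_on_diff[OF continuous_on_const, of UNIV ?\<theta> 2] by argo
qed

end

text \<open>This is the case of two index points, transported from functions on
  \<open>{..<2}\<close> to the product type.\<close>

lemma continuous_on_finite_sets_pair:
  fixes f :: "'t::metric_space fset \<Rightarrow> real"
  assumes "continuous_on_finite_sets f"
  shows "continuous_on UNIV (\<lambda>(s, t). f {|s, t|})"
proof -
  \<comment> \<open>The restriction makes the images extensional, as points of the product topology
    must be.\<close>
  let ?h = "\<lambda>p::'t \<times> 't. \<lambda>i\<in>{..<2::nat}. if i = 0 then fst p else snd p"
  have "continuous_map euclidean (product_topology (\<lambda>_. euclidean) {..<2::nat}) ?h"
    by (auto simp: continuous_map_componentwise continuous_on_fst continuous_on_snd)
  from continuous_map_compose[OF this, of euclideanreal "\<lambda>t. f (fset_of_list (map t [0..<2]))"] assms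
  have "continuous_map euclidean euclideanreal ((\<lambda>t. f (fset_of_list (map t [0..<2]))) \<circ> ?h)"
    unfolding continuous_on_finite_sets_def by blast
  moreover have "(\<lambda>t. f (fset_of_list (map t [0..<2]))) \<circ> ?h = (\<lambda>(s, t). f {|s, t|})"
    by (auto simp: fun_eq_iff numeral_2_eq_2)
  ultimately show ?thesis
    by (simp only: continuous_map_iff_continuous2)
qed

text \<open>A cycle closes: continuity on finite sets implies continuity on pairs, which implies
  stochastic continuity, which implies continuity on finite sets. The correlation enters through its
  equivalence with the pair condition.\<close>

lemma stochastically_continuous_iff:
  fixes X :: "'t::metric_space \<Rightarrow> 'w \<Rightarrow> real"
  assumes "Frechet_max_stable_field M X"
  shows "stochastically_continuous M X \<longleftrightarrow> continuous_on_finite_sets (extremal_coefficient M X)"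
    and "stochastically_continuous M X \<longleftrightarrow> continuous_on UNIV (extremal_correlation M X)"
proof -
  interpret Frechet_field_metric M X
    by unfold_locales (fact assms)
  show "stochastically_continuous M X \<longleftrightarrow> continuous_on_finite_sets (extremal_coefficient M X)"
    and "stochastically_continuous M X \<longleftrightarrow> continuous_on UNIV (extremal_correlation M X)"
    using stochastically_continuousI continuous_on_finite_sets_extremal_coefficient
      continuous_on_finite_sets_pair continuous_extremal_correlation_iff by blast+
qed

theorem corollary17:
  shows "{\<theta> :: 't::metric_space fset \<Rightarrow> real.
            continuous_on_finite_sets \<theta> \<and>
            (\<exists>(M :: 'w measure) X. Frechet_max_stable_field M X \<and>
               \<theta> = extremal_coefficient M X)} =
         {\<theta>. \<exists>(M :: 'w measure) X. Frechet_max_stable_field M X \<and>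
               stochastically_continuous M X \<and> \<theta> = extremal_coefficient M X} \<and>
         {C :: 't \<times> 't \<Rightarrow> real.
            continuous_on UNIV C \<and>
            (\<exists>(M :: 'w measure) X. Frechet_max_stable_field M X \<and>
               C = extremal_correlation M X)} =
         {C. \<exists>(M :: 'w measure) X. Frechet_max_stable_field M X \<and>
               stochastically_continuous M X \<and> C = extremal_correlation M X}"
  using stochastically_continuous_iff by blast

end
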